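(* Let $L$ be a crowded linearly ordered topological space. Then $\mathrm{os}_2(L)<\widehat{c}(L)$ implies $d(L)<\widehat{c}(L)$. Consequently, if $L$ is a $\kappa$-Suslin line for an uncountable regular cardinal $\kappa$, then every (crowded Hausdorff) nowhere constant image $Y$ of $L$ satisfies $w(Y)\ge\kappa=\widehat{c}(L)$.
   Context: A space is crowded if it has no isolated points. $d(L)$ is the density of $L$ (minimum cardinality of a dense subset) and $w(Y)$ the weight of $Y$ (minimum cardinality of a base). $\widehat{c}(L)$ is the smallest cardinal $\kappa$ such that there is no family of $\kappa$ many pairwise disjoint non-empty open subsets of $L$. $\mathrm{os}_2(L)$ is the minimum cardinality of a family $\mathcal{U}$ of open subsets of $L$ such that for every non-empty open $G\subseteq L$ there are disjoint $U_0,U_1\in\mathcal{U}$ both meeting $G$. A $\kappa$-Suslin line is a crowded linearly ordered topological space $L$ with $\widehat{c}(L)=\kappa\le d(L)$. $Y$ is a nowhere constant image of $L$ if there is a continuous surjection $f:L\to Y$ with $|f[U]|>1$ for every non-empty open $U\subseteq L$. *)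

theory Defs
  imports "HOL-Analysis.Analysis"
begin

unbundle cardinal_syntax

text \<open>
  Cardinals are represented by cardinal orders, as in the BNF cardinal library. A space is the
  universe of a type, passed as an argument \<open>TYPE('a)\<close>. Crowdedness is the class
  \<^class>\<open>perfect_space\<close>, which says that no singleton is open.
\<close>

text \<open>The minimum cardinality of a set satisfying \<open>P\<close>; unspecified if there is no such set.\<close>

definition min_card :: "('a set \<Rightarrow> bool) \<Rightarrow> 'a rel" where
  "min_card P = card_of (SOME A. P A \<and> (\<forall>B. P B \<longrightarrow> |A| \<le>o |B| ))"

definition top_density :: "'a::topological_space itself \<Rightarrow> 'a rel" where
  "top_density _ = min_card (\<lambda>D::'a set. closure D = UNIV)"

definition weight :: "'a::topological_space itself \<Rightarrow> 'a set rel" where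
  "weight _ = min_card (\<lambda>B::'a set set. topological_basis B)"

definition cellular_family :: "'a::topological_space set set \<Rightarrow> bool" where
  "cellular_family \<F> \<longleftrightarrow> (\<forall>U\<in>\<F>. open U \<and> U \<noteq> {}) \<and> pairwise disjnt \<F>"

text \<open>
  The cardinal \<open>c_hat\<close> is the least one that is not the cardinality of a cellular family. It
  suffices to let \<open>K\<close> range over subsets of \<open>'a set\<close>: a cellular family embeds into \<open>'a\<close>, so
  the cardinality of \<open>'a set\<close> is never attained.
\<close>

definition c_hat :: "'a::topological_space itself \<Rightarrow> 'a set rel" where
  "c_hat _ = min_card (\<lambda>K::'a set set. \<not> (\<exists>\<F>::'a set set. cellular_family \<F> \<and> |\<F>| =o |K| ))"

text \<open>
  In a crowded Hausdorff space, the family of all open sets satisfies the condition below.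
\<close>

definition os2 :: "'a::topological_space itself \<Rightarrow> 'a set rel" where
  "os2 _ = min_card (\<lambda>\<U>::'a set set. (\<forall>U\<in>\<U>. open U) \<and>
     (\<forall>G. open G \<and> G \<noteq> {} \<longrightarrow>
       (\<exists>U\<^sub>0\<in>\<U>. \<exists>U\<^sub>1\<in>\<U>. U\<^sub>0 \<inter> U\<^sub>1 = {} \<and> U\<^sub>0 \<inter> G \<noteq> {} \<and> U\<^sub>1 \<inter> G \<noteq> {})))"

definition Suslin_line :: "'k rel \<Rightarrow> 'a::{linorder_topology, perfect_space} itself \<Rightarrow> bool" where
  "Suslin_line \<kappa> _ \<longleftrightarrow> c_hat TYPE('a) =o \<kappa> \<and> \<kappa> \<le>o top_density TYPE('a)"

text \<open>
  That \<open>f ` U\<close> has more than one point is not expressed with \<^const>\<open>card\<close>, which is \<open>0\<close> on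
  infinite sets.
\<close>

definition nowhere_constant_image ::
    "'b::topological_space itself \<Rightarrow> 'a::topological_space itself \<Rightarrow> bool" where
  "nowhere_constant_image _ _ \<longleftrightarrow>
     (\<exists>f :: 'a \<Rightarrow> 'b. continuous_on UNIV f \<and> surj f \<and>
       (\<forall>U. open U \<and> U \<noteq> {} \<longrightarrow> (\<exists>y\<in>f ` U. \<exists>z\<in>f ` U. y \<noteq> z)))"

end

theory Submission
  imports Defs
begin

text \<open>
  Let \<open>\<U>\<close> witness \<open>os2 L\<close>. In each \<open>U \<in> \<U>\<close> one finds a set \<open>D U\<close> of size less than \<open>c_hat L\<close> that
  is cofinal in every convex component of \<open>U\<close>. An open interval \<open>G\<close> meets two disjoint members of
  \<open>\<U>\<close>, so, going from the left one \<open>U\<close> to the other, one leaves a component of \<open>U\<close> inside \<open>G\<close>, and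
  \<open>D U\<close> meets \<open>G\<close>. Hence the union of the sets \<open>D U\<close> is dense. Its size is less than \<open>c_hat L\<close>
  because \<open>c_hat L\<close> is regular (Erdos-Tarski). The second part follows because the preimages of a
  base of \<open>Y\<close> form such a \<open>\<U>\<close>.
\<close>

section \<open>Minimum cardinalities and maximal disjoint families\<close>

text \<open>Cardinals are well-founded, so the choice in \<open>min_card\<close> is genuine as soon
  as one set satisfies \<open>P\<close>.\<close>

lemma min_card_witness:
  assumes "P A"
  obtains M where "P M" "min_card P = |M|" "\<And>B. P B \<Longrightarrow> |M| \<le>o |B|"
proof -
  have "\<exists>r\<in>{|B| |B. P B}. \<forall>r'\<in>{|B| |B. P B}. r \<le>o r'"
    using assms by (intro exists_minim_Card_order) (auto simp: card_of_Card_order)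
  then have "\<exists>A. P A \<and> (\<forall>B. P B \<longrightarrow> |A| \<le>o |B| )"
    by blast
  from someI_ex[OF this] show thesis
    using that[OF _ min_card_def[of P]] by simp
qed

lemma min_card_ordLeq:
  assumes "P A"
  shows "min_card P \<le>o |A|"
proof -
  obtain M where "P M" and M: "min_card P = |M|" and least: "\<And>B. P B \<Longrightarrow> |M| \<le>o |B|"
    by (rule min_card_witness[of P, OF assms]) (rule that)
  show ?thesis
    unfolding M by (rule least[OF assms])
qed

text \<open>Zorn's lemma gives a maximal disjoint subfamily of \<open>\<Q>\<close>; a nonempty
  \<open>Q\<close> missing all its members could still be added.\<close>

lemma maximal_pairwise_disjnt:
  obtains \<G> where "\<G> \<subseteq> \<Q>" "pairwise disjnt \<G>"
    "\<And>Q. Q \<in> \<Q> \<Longrightarrow> Q \<noteq> {} \<Longrightarrow> \<exists>G\<in>\<G>. Q \<inter> G \<noteq> {}"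
proof -
  let ?A = "{\<G>. \<G> \<subseteq> \<Q> \<and> pairwise disjnt \<G>}"
  have "\<exists>M\<in>?A. \<forall>X\<in>?A. M \<subseteq> X \<longrightarrow> X = M"
  proof (rule subset_Zorn')
    fix C assume C: "subset.chain ?A C"
    have "pairwise disjnt (\<Union>C)"
    proof (rule pairwiseI)
      fix U V assume "U \<in> \<Union>C" "V \<in> \<Union>C" "U \<noteq> V"
      then obtain X Z where XZ: "X \<in> C" "U \<in> X" "Z \<in> C" "V \<in> Z"
        by blast
      then have "X \<subseteq> Z \<or> Z \<subseteq> X" "pairwise disjnt X" "pairwise disjnt Z"
        using C unfolding subset_chain_def by auto
      then show "disjnt U V"
        using XZ \<open>U \<noteq> V\<close> by (meson pairwiseD subsetD)
    qed
    moreover have "\<Union>C \<subseteq> \<Q>"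
      using C unfolding subset_chain_def by auto
    ultimately show "\<Union>C \<in> ?A"
      by simp
  qed
  then obtain M where "M \<in> ?A" and "\<forall>X\<in>?A. M \<subseteq> X \<longrightarrow> X = M"
    by (rule bexE)
  then have M: "M \<subseteq> \<Q>" "pairwise disjnt M"
    and max: "\<And>X. X \<subseteq> \<Q> \<Longrightarrow> pairwise disjnt X \<Longrightarrow> M \<subseteq> X \<Longrightarrow> X = M"
    by simp_all
  show thesis
  proof (rule that[OF M])
    fix Q assume Q: "Q \<in> \<Q>" "Q \<noteq> {}"
    show "\<exists>G\<in>M. Q \<inter> G \<noteq> {}"
    proof (rule ccontr)
      assume none: "\<not> ?thesis"
      \<comment> \<open>Thus \<open>Q\<close> is itself a member of \<open>M\<close>, and being
        nonempty it meets itself.\<close>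
      then have "insert Q M = M"
        using Q M by (intro max) (auto simp: pairwise_insert disjnt_def)
      with none Q show False by blast
    qed
  qed
qed

text \<open>A smaller well-order is isomorphic to a proper initial segment. Claims about all sets
  below \<open>r\<close>, of whatever type, can thus be tested on the segments
  \<open>underS r x\<close>.\<close>

lemma ordLess_imp_ordLeq_underS:
  assumes "Card_order r" "|S| <o r"
  obtains x where "x \<in> Field r" "|S| \<le>o |underS r x|"
proof -
  have wo: "Well_order r"
    using assms(1) by (simp add: card_order_on_def)
  obtain x where x: "x \<in> Field r" "|S| =o Restr r (underS r x)"
    using assms(2) unfolding ordLess_iff_ordIso_Restr[OF wo card_of_Well_order] by (rule bexE)
  have "underS r x \<subseteq> Field r"
    by (auto simp: underS_def Field_def)
  then have "Field (Restr r (underS r x)) = underS r x"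
    using wo by (simp add: Refl_Field_Restr2 wo_rel.REFL wo_rel_def)
  then have "|S| \<le>o |underS r x|"
    using card_of_mono2[OF ordIso_imp_ordLeq[OF x(2)]] by (simp add: Field_card_of)
  with x(1) show thesis by (rule that)
qed

section \<open>Indexed cellular families inside a set\<close>

text \<open>Indexing by a set of arbitrary type makes the notion depend only on the cardinality of
  \<open>S\<close> and lets families be combined over a \<open>Sigma\<close>. Disjoint nonempty
  values force \<open>g\<close> to be injective on \<open>S\<close>.\<close>

definition cells :: "'a::topological_space set \<Rightarrow> 'i set \<Rightarrow> bool" where
  "cells V S \<longleftrightarrow>
     (\<exists>g. disjoint_family_on g S \<and> (\<forall>s\<in>S. open (g s) \<and> g s \<noteq> {} \<and> g s \<subseteq> V))"

lemma cells_ordLeq: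
  assumes "cells V S" "|T| \<le>o |S|"
  shows "cells V T"
proof -
  obtain g where g: "disjoint_family_on g S" "\<forall>s\<in>S. open (g s) \<and> g s \<noteq> {} \<and> g s \<subseteq> V"
    using assms(1) unfolding cells_def by (elim exE conjE)
  obtain f where f: "inj_on f T" "f ` T \<subseteq> S"
    using assms(2) unfolding card_of_ordLeq[symmetric] by (elim exE conjE)
  have "disjoint_family_on (g \<circ> f) T"
    unfolding disjoint_family_on_def
  proof (intro ballI impI)
    fix s t assume st: "s \<in> T" "t \<in> T" "s \<noteq> t"
    then have "f s \<noteq> f t" "f s \<in> S" "f t \<in> S"
      using f by (auto simp: inj_on_eq_iff)
    then show "(g \<circ> f) s \<inter> (g \<circ> f) t = {}"
      using g(1) by (simp add: disjoint_family_on_def)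
  qed
  with g(2) f(2) show ?thesis
    unfolding cells_def by (intro exI[of _ "g \<circ> f"]) auto
qed

text \<open>Cells with the same first index are separated inside \<open>g i\<close>, all others by
  the disjointness of \<open>g\<close>.\<close>

lemma cells_Sigma:
  assumes g: "disjoint_family_on g I" "\<And>i. i \<in> I \<Longrightarrow> g i \<subseteq> V"
    and F: "\<And>i. i \<in> I \<Longrightarrow> cells (g i) (F i)"
  shows "cells V (Sigma I F)"
proof -
  obtain h where h: "\<And>i. i \<in> I \<Longrightarrow> disjoint_family_on (h i) (F i) \<and>
      (\<forall>s\<in>F i. open (h i s) \<and> h i s \<noteq> {} \<and> h i s \<subseteq> g i)"
    using F unfolding cells_def by metis
  have "h i s \<inter> h j t = {}"
    if *: "i \<in> I" "s \<in> F i" "j \<in> I" "t \<in> F j" "(i, s) \<noteq> (j, t)" for i s j t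
  proof (cases "i = j")
    case True
    then show ?thesis
      using * h[of i] by (auto simp: disjoint_family_on_def)
  next
    case False
    then have "g i \<inter> g j = {}"
      using * g(1) by (auto simp: disjoint_family_on_def)
    then show ?thesis
      using * h[of i] h[of j] by blast
  qed
  then have "disjoint_family_on (\<lambda>(i, s). h i s) (Sigma I F)"
    unfolding disjoint_family_on_def by fastforce
  moreover have "\<forall>x\<in>Sigma I F. open ((\<lambda>(i, s). h i s) x) \<and> (\<lambda>(i, s). h i s) x \<noteq> {} \<and>
      (\<lambda>(i, s). h i s) x \<subseteq> V"
    using h g(2) by fastforce
  ultimately show ?thesis
    unfolding cells_def by blast
qed

lemma cellular_family_imp_cells:
  fixes \<F> :: "'a::topological_space set set"
  assumes "cellular_family \<F>"
  shows "cells (UNIV::'a set) \<F>"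
  using assms
  unfolding cells_def cellular_family_def disjoint_family_on_def pairwise_def disjnt_def
  by (intro exI[of _ "\<lambda>U. U"]) auto

lemma cells_imp_cellular_family:
  fixes S :: "'i set"
  assumes "cells (UNIV::'a::topological_space set) S"
  obtains \<F> :: "'a::topological_space set set" where "cellular_family \<F>" "|\<F>| =o |S|"
proof -
  obtain g :: "'i \<Rightarrow> 'a set"
    where g: "disjoint_family_on g S" "\<forall>s\<in>S. open (g s) \<and> g s \<noteq> {}"
    using assms unfolding cells_def by blast
  have "inj_on g S"
    using g unfolding inj_on_def disjoint_family_on_def by (metis inf.idem)
  then have "|g ` S| =o |S|"
    by (intro ordIso_symmetric[OF card_of_ordIsoI[of g]]) (simp add: bij_betw_def)
  moreover have "cellular_family (g ` S)"
    unfolding cellular_family_def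
  proof (intro conjI pairwise_imageI)
    show "disjnt (g s) (g t)" if "s \<in> S" "t \<in> S" "s \<noteq> t" for s t
      using g(1) that by (simp add: disjoint_family_on_def disjnt_def)
  qed (use g(2) in blast)
  ultimately show thesis by (rule that[rotated])
qed

lemma cellular_family_ordLeq:
  fixes \<F> :: "'a::topological_space set set"
  assumes "cellular_family \<F>"
  shows "|\<F>| \<le>o |UNIV :: 'a set|"
proof (rule card_of_ordLeqI)
  show "inj_on (\<lambda>U. SOME x. x \<in> U) \<F>"
    using assms unfolding inj_on_def cellular_family_def pairwise_def disjnt_iff
    by (metis ex_in_conv someI_ex)
qed auto

text \<open>Cardinals below \<open>c_hat\<close> are attained by minimality. Conversely, the
  attained cardinals are closed downwards, so none can reach \<open>c_hat\<close>, which is not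
  attained.\<close>

lemma c_hat_iff_cells:
  fixes S :: "'i set"
  shows "|S| <o c_hat TYPE('a::topological_space) \<longleftrightarrow> cells (UNIV::'a::topological_space set) S"
proof -
  let ?P = "\<lambda>K::'a set set. \<not> (\<exists>\<F>::'a set set. cellular_family \<F> \<and> |\<F>| =o |K| )"
  have "?P UNIV"
  proof clarify
    fix \<F> :: "'a set set"
    assume "cellular_family \<F>" and eq: "|\<F>| =o |UNIV::'a set set|"
    then have "|\<F>| <o |UNIV::'a set set|"
      using ordLeq_ordLess_trans[OF cellular_family_ordLeq card_of_Pow[of "UNIV::'a set"]] by simp
    with eq show False
      using not_ordLess_ordIso by blast
  qed
  then obtain K where K: "?P K" "min_card ?P = |K|" and least: "\<And>B. ?P B \<Longrightarrow> |K| \<le>o |B|"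
    by (rule min_card_witness[where P="?P"]) (rule that)
  have c_hat: "c_hat TYPE('a) = |K|"
    using K(2) by (simp add: c_hat_def)
  show ?thesis
  proof
    assume less: "|S| <o c_hat TYPE('a)"
    \<comment> \<open>A copy of \<open>S\<close> inside \<open>K\<close> has the type over which
      \<open>c_hat\<close> minimizes.\<close>
    then obtain T where T: "T \<subseteq> K" "|S| =o |T|"
      using internalize_card_of_ordLeq2[of S K] c_hat ordLess_imp_ordLeq by force
    have "|T| <o |K|"
      using less T(2) c_hat by (metis ordIso_ordLess_trans ordIso_symmetric)
    then have "\<not> ?P T"
      using least not_ordLess_ordLeq by blast
    then obtain \<F> :: "'a set set" where "cellular_family \<F>" "|\<F>| =o |T|"
      by blast
    then show "cells (UNIV::'a set) S"
      using cells_ordLeq[OF cellular_family_imp_cells] ordIso_symmetric[of "|\<F>|"]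
        ordIso_transitive[OF T(2)] ordIso_imp_ordLeq by blast
  next
    assume S: "cells (UNIV::'a set) S"
    have "\<not> |K| \<le>o |S|"
      using cells_ordLeq[OF S] cells_imp_cellular_family K(1) by blast
    then show "|S| <o c_hat TYPE('a)"
      using c_hat by (simp add: not_ordLeq_iff_ordLess card_of_Well_order)
  qed
qed

lemma cells_if_cells_underS:
  assumes "Card_order r" "\<And>x. x \<in> Field r \<Longrightarrow> cells V (underS r x)" "|S| <o r"
  shows "cells V S"
proof -
  obtain x where "x \<in> Field r" "|S| \<le>o |underS r x|"
    by (rule ordLess_imp_ordLeq_underS[OF assms(1,3)])
  then show ?thesis
    using assms(2) cells_ordLeq by blast
qed

text \<open>By density each cell meets some member of \<open>\<G>\<close>. The traces of the cells
  on a fixed \<open>V\<close> form a cellular family in \<open>V\<close>, so fewer than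
  \<open>|T|\<close> cells meet that \<open>V\<close>.\<close>

lemma cells_ordLeq_Times:
  fixes \<G> :: "'a::topological_space set set" and S :: "'s set"
  assumes \<G>: "\<forall>V\<in>\<G>. open V \<and> \<not> cells V T"
    and dense: "\<forall>W. open W \<and> W \<noteq> {} \<longrightarrow> (\<exists>G\<in>\<G>. W \<inter> G \<noteq> {})"
    and S: "cells (UNIV::'a set) S"
  shows "|S| \<le>o |\<G> \<times> T|"
proof -
  obtain g :: "'s \<Rightarrow> 'a set"
    where g: "disjoint_family_on g S" "\<forall>s\<in>S. open (g s) \<and> g s \<noteq> {}"
    using S unfolding cells_def by blast
  let ?S = "\<lambda>V. {s\<in>S. g s \<inter> V \<noteq> {}}"
  have le: "|?S V| \<le>o |T|" if V: "V \<in> \<G>" for V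
  proof -
    have "disjoint_family_on (\<lambda>s. g s \<inter> V) (?S V)"
      using g(1) unfolding disjoint_family_on_def by blast
    then have "cells V (?S V)"
      unfolding cells_def using g(2) \<G> V by (intro exI[of _ "\<lambda>s. g s \<inter> V"]) (simp add: open_Int)
    then have "\<not> |T| \<le>o |?S V|"
      using cells_ordLeq \<G> V by blast
    then have "|?S V| <o |T|"
      by (simp add: not_ordLeq_iff_ordLess card_of_Well_order)
    then show ?thesis
      by (rule ordLess_imp_ordLeq)
  qed
  have "\<exists>V\<in>\<G>. g s \<inter> V \<noteq> {}" if "s \<in> S" for s
    using g(2) that dense by auto
  then have "S = (\<Union>V\<in>\<G>. ?S V)"
    by auto
  then have "|S| \<le>o |SIGMA V:\<G>. ?S V|"
    using card_of_UNION_Sigma[of ?S \<G>] by simp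
  also have "|SIGMA V:\<G>. ?S V| \<le>o |\<G> \<times> T|"
    using le by (intro card_of_Sigma_mono1) blast
  finally show ?thesis .
qed

section \<open>Infinite cellular families in crowded Hausdorff spaces\<close>

lemma perfect_t2_disjoint_open:
  fixes U :: "'a::{t2_space, perfect_space} set"
  assumes "open U" "U \<noteq> {}"
  obtains V W where "open V" "open W" "V \<noteq> {}" "W \<noteq> {}" "V \<inter> W = {}" "V \<subseteq> U" "W \<subseteq> U"
proof -
  obtain x where "x \<in> U" using assms by blast
  moreover have "U \<noteq> {x}" using assms(1) not_open_singleton[of x] by metis
  ultimately obtain y where xy: "x \<in> U" "y \<in> U" "x \<noteq> y" by blast
  then obtain V W where "open V" "open W" "x \<in> V" "y \<in> W" "V \<inter> W = {}"
    using hausdorff[OF xy(3)] by blast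
  then show thesis
    using xy assms by (intro that[of "V \<inter> U" "W \<inter> U"]) auto
qed

text \<open>Each stage splits an open set in two: the first half is kept as a cell, and the next
  stage works inside the second half.\<close>

lemma cells_nat: "cells (UNIV::'a::{t2_space, perfect_space} set) (UNIV::nat set)"
proof -
  let ?P = "\<lambda>n (p::'a set \<times> 'a set). open (fst p) \<and> open (snd p) \<and> fst p \<noteq> {} \<and> snd p \<noteq> {} \<and>
    fst p \<inter> snd p = {}"
  have step: "\<exists>q. ?P n q \<and> fst q \<union> snd q \<subseteq> U" if U: "open U" "U \<noteq> {}" for U n
  proof -
    obtain V W where "open V" "open W" "V \<noteq> {}" "W \<noteq> {}" "V \<inter> W = {}" "V \<subseteq> U" "W \<subseteq> U"
      by (rule perfect_t2_disjoint_open[OF U])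
    then show ?thesis
      by (intro exI[of _ "(V, W)"]) simp
  qed
  obtain f where f: "\<forall>n. ?P n (f n) \<and> fst (f (Suc n)) \<union> snd (f (Suc n)) \<subseteq> snd (f n)"
  proof (rule exE[OF dependent_nat_choice[where P="?P" and Q="\<lambda>n p q. fst q \<union> snd q \<subseteq> snd p"]])
    show "\<exists>p. ?P 0 p"
      using step[OF open_UNIV UNIV_not_empty] by blast
    show "\<exists>q. ?P (Suc n) q \<and> fst q \<union> snd q \<subseteq> snd p" if "?P n p" for p n
      using step[of "snd p"] that by blast
  qed (rule that)
  have "snd (f (Suc n)) \<subseteq> snd (f n)" for n
    using f by blast
  then have dec: "snd (f n) \<subseteq> snd (f m)" if "m \<le> n" for m n
    by (rule lift_Suc_antimono_le[OF _ that])
  have "fst (f m) \<inter> fst (f n) = {}" if "m < n" for m n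
  proof -
    \<comment> \<open>The cell at stage \<open>Suc k\<close> lies in the second half of stage
      \<open>k\<close>, hence in that of stage \<open>m\<close>, which misses the cell of stage
      \<open>m\<close>.\<close>
    obtain k where "n = Suc k" "m \<le> k" using \<open>m < n\<close> by (cases n) auto
    then show ?thesis using dec[of m k] f by blast
  qed
  then have "disjoint_family (\<lambda>n. fst (f n))"
    unfolding disjoint_family_on_def by (metis Int_commute nat_neq_iff)
  then show ?thesis
    using f unfolding cells_def by blast
qed

lemma c_hat_infinite:
  obtains K :: "'a::{t2_space, perfect_space} set set"
  where "c_hat TYPE('a) = |K|" "infinite K"
proof -
  obtain K :: "'a set set" where K: "c_hat TYPE('a) = |K|"
    unfolding c_hat_def min_card_def by blast
  have "|UNIV::nat set| <o |K|"
    using cells_nat[where 'a='a] unfolding c_hat_iff_cells[symmetric] K .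
  then have "infinite K"
    unfolding infinite_iff_card_of_nat by (rule ordLess_imp_ordLeq)
  with K show thesis by (rule that)
qed

section \<open>Regularity of \<open>c_hat\<close>\<close>

text \<open>The product embeds into the square of the disjoint sum \<open>?D\<close>, and an
  infinite \<open>?D\<close> is equinumerous with its square.\<close>

lemma card_of_Times_ordLess_infinite:
  assumes "infinite C" "|A| <o |C|" "|B| <o |C|"
  shows "|A \<times> B| <o |C|"
proof -
  let ?D = "A <+> B"
  have D: "|?D| <o |C|"
    using assms by (rule card_of_Plus_ordLess_infinite)
  have "|?D \<times> ?D| <o |C|"
  proof (cases "finite ?D")
    case True
    then have "finite (?D \<times> ?D)" by blast
    then show ?thesis
      using assms(1)
      by (intro finite_ordLess_infinite card_of_Well_order) (simp_all only: Field_card_of not_False_eq_True)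
  next
    case False
    show ?thesis
      by (rule ordIso_ordLess_trans[OF card_of_Times_same_infinite[OF False] D])
  qed
  moreover have "|A \<times> B| \<le>o |?D \<times> ?D|"
    using card_of_Times_mono1[OF card_of_Plus1] card_of_Times_mono2[OF card_of_Plus2]
    by (rule ordLeq_transitive)
  ultimately show ?thesis
    using ordLeq_ordLess_trans by blast
qed

text \<open>
  The Erdos-Tarski theorem. Call \<open>V\<close> full if it has cellular families of every size below \<open>c_hat\<close>. If
  all open subsets of some \<open>V\<close> are full, cellular families can be nested inside \<open>V\<close>. Otherwise let
  \<open>\<G>\<close> be a maximal disjoint family of sets that are not full; its union is dense. Either the sets
  in \<open>\<G>\<close> are uniformly not full, which bounds the size of all cellular families, or cellular
  families of unbounded size in different members of \<open>\<G>\<close> combine into one of size \<open>c_hat\<close>.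
\<close>

lemma c_hat_regular:
  fixes I :: "'i set" and F :: "'i \<Rightarrow> 'j set"
  assumes I: "|I| <o c_hat TYPE('a::{t2_space, perfect_space})"
    and F: "\<And>i. i \<in> I \<Longrightarrow> |F i| <o c_hat TYPE('a::{t2_space, perfect_space})"
  shows "|Sigma I F| <o c_hat TYPE('a::{t2_space, perfect_space})"
proof -
  obtain K :: "'a set set" where K: "c_hat TYPE('a) = |K|" and inf: "infinite K"
    by (rule c_hat_infinite)
  define r where "r = |K|"
  have FK: "Field r = K" and rK: "|K| = r"
    by (simp_all add: r_def Field_card_of)
  have cr: "Card_order r"
    unfolding r_def by (rule card_of_Card_order)
  interpret wo_rel r
    by unfold_locales (simp add: r_def card_of_Well_order)
  note less_iff = c_hat_iff_cells[where 'a='a, unfolded K, folded r_def]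
  \<comment> \<open>By \<open>cells_if_cells_underS\<close>, initial segments of \<open>K\<close>
    suffice to test all sizes below \<open>c_hat\<close>.\<close>
  define full where "full V \<longleftrightarrow> (\<forall>x\<in>K. cells V (underS x))" for V :: "'a set"
  show ?thesis
  proof (cases "\<exists>V. open V \<and> V \<noteq> {} \<and> (\<forall>V'\<subseteq>V. open V' \<and> V' \<noteq> {} \<longrightarrow> full V')")
    case True
    then obtain V where V: "open V" "V \<noteq> {}" "\<And>V'. V' \<subseteq> V \<Longrightarrow> open V' \<Longrightarrow> V' \<noteq> {} \<Longrightarrow> full V'"
      by blast
    have "cells V I"
    proof (rule cells_if_cells_underS[OF cr])
      show "cells V (underS x)" if "x \<in> Field r" for x
        using V(3)[OF subset_refl V(1,2)] that unfolding full_def FK by blast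
      show "|I| <o r"
        using I unfolding K r_def .
    qed
    then obtain g where g: "disjoint_family_on g I" "\<forall>i\<in>I. open (g i) \<and> g i \<noteq> {} \<and> g i \<subseteq> V"
      unfolding cells_def by blast
    have "cells (UNIV::'a set) (Sigma I F)"
    proof (rule cells_Sigma[OF g(1)])
      fix i assume i: "i \<in> I"
      then have "full (g i)"
        using g(2) V(3) by blast
      then have "cells (g i) (underS x)" if "x \<in> Field r" for x
        using that unfolding full_def FK by blast
      then show "cells (g i) (F i)"
        using F[OF i] unfolding K rK by (rule cells_if_cells_underS[OF cr])
    qed simp
    then show ?thesis
      using less_iff[of "Sigma I F"] unfolding K r_def by blast
  next
    case False
    obtain \<G> where \<G>: "\<G> \<subseteq> {V. open V \<and> V \<noteq> {} \<and> \<not> full V}" "pairwise disjnt \<G>"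
      and max: "\<And>Q. Q \<in> {V. open V \<and> V \<noteq> {} \<and> \<not> full V} \<Longrightarrow> Q \<noteq> {} \<Longrightarrow> \<exists>G\<in>\<G>. Q \<inter> G \<noteq> {}"
      by (rule maximal_pairwise_disjnt[of "{V. open V \<and> V \<noteq> {} \<and> \<not> full V}"]) (rule that)
    have dense: "\<forall>W. open W \<and> W \<noteq> {} \<longrightarrow> (\<exists>G\<in>\<G>. W \<inter> G \<noteq> {})"
    proof (intro allI impI)
      fix W :: "'a set" assume W: "open W \<and> W \<noteq> {}"
      have "\<not> (\<forall>V\<subseteq>W. open V \<and> V \<noteq> {} \<longrightarrow> full V)"
        using False W by auto
      then obtain V where "V \<subseteq> W" "open V" "V \<noteq> {}" "\<not> full V"
        by auto
      with max[of V] show "\<exists>G\<in>\<G>. W \<inter> G \<noteq> {}" by auto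
    qed
    have "cells (UNIV::'a set) \<G>"
      using \<G> by (intro cellular_family_imp_cells) (auto simp: cellular_family_def)
    then have card\<G>: "|\<G>| <o r"
      using less_iff by blast
    show ?thesis
    proof (cases "\<exists>x\<in>K. \<forall>V\<in>\<G>. \<not> cells V (underS x)")
      case True
      then obtain x where x: "x \<in> K" "\<And>V. V \<in> \<G> \<Longrightarrow> \<not> cells V (underS x)"
        by blast
      let ?B = "\<G> \<times> underS x"
      have "\<forall>V\<in>\<G>. open V \<and> \<not> cells V (underS x)"
        using \<G>(1) x(2) by blast
      note bound = cells_ordLeq_Times[OF this dense]
      have "|underS x| <o r"
        using card_of_underS[OF cr] x(1) FK by blast
      then have B: "|?B| <o r"
        using card_of_Times_ordLess_infinite[OF inf, of \<G> "underS x"] card\<G> by (simp add: rK)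
      \<comment> \<open>The bound is applied to a countable cellular family. As \<open>?B\<close> is
        infinite, it absorbs a sum of at most \<open>|?B|\<close> sets of size at most
        \<open>|?B|\<close>.\<close>
      have "infinite ?B"
        unfolding infinite_iff_card_of_nat by (rule bound[OF cells_nat])
      then have "|Sigma I F| \<le>o |?B|"
        using I F unfolding c_hat_iff_cells
        by (intro card_of_Sigma_ordLeq_infinite) (auto intro!: bound)
      then show ?thesis
        using B unfolding K r_def by (rule ordLeq_ordLess_trans)
    next
      case False
      \<comment> \<open>The threshold at which \<open>V\<close> first fails to be full; below it all
        segments are realized by \<open>cells_below\<close>.\<close>
      define h where "h V = minim {x\<in>K. \<not> cells V (underS x)}" for V :: "'a set"
      have h: "h V \<in> K" "\<not> cells V (underS (h V))"
        and h_least: "\<And>x. x \<in> K \<Longrightarrow> \<not> cells V (underS x) \<Longrightarrow> (h V, x) \<in> r" if "V \<in> \<G>" for V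
      proof -
        have ne: "{x\<in>K. \<not> cells V (underS x)} \<noteq> {}"
          using that \<G>(1) unfolding full_def by blast
        have "h V \<in> {x\<in>K. \<not> cells V (underS x)}"
          unfolding h_def using minim_in[OF _ ne] FK by blast
        then show "h V \<in> K" "\<not> cells V (underS (h V))" by auto
        show "(h V, x) \<in> r" if "x \<in> K" "\<not> cells V (underS x)" for x
          unfolding h_def using that FK by (intro minim_least) auto
      qed
      have cells_below: "cells V (underS x)" if "V \<in> \<G>" "(x, h V) \<in> r" "x \<noteq> h V" for V x
        using h_least[OF that(1), of x] that ANTISYM FK unfolding antisym_def
        by (metis FieldI1)
      define X where "X = h ` \<G>"
      have XK: "X \<subseteq> K" using h unfolding X_def by blast
      \<comment> \<open>The thresholds are unbounded in \<open>K\<close>: some \<open>V\<close>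
        realizes \<open>underS x\<close>, so its threshold lies beyond \<open>x\<close>.\<close>
      have above: "\<exists>y\<in>X. (x, y) \<in> r \<and> x \<noteq> y" if x: "x \<in> K" for x
      proof -
        obtain V where V: "V \<in> \<G>" "cells V (underS x)"
          using False x by blast
        have "\<not> (h V, x) \<in> r"
        proof
          assume *: "(h V, x) \<in> r"
          then have "underS (h V) \<subseteq> underS x"
            using TRANS ANTISYM unfolding underS_def trans_def antisym_def by blast
          then show False
            using h(2)[OF V(1)] cells_ordLeq[OF V(2)] card_of_mono1 by blast
        qed
        moreover have "(x, x) \<in> r"
          using x REFL FK by (simp add: refl_on_def)
        ultimately show ?thesis
          using in_notinI[of x "h V"] x h(1)[OF V(1)] V(1) FK TOTALS unfolding X_def by blast
      qed
      \<comment> \<open>A set with threshold \<open>x\<close> does not realize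
        \<open>underS x\<close>, but one whose threshold is the successor of \<open>x\<close> in
        \<open>X\<close> does. This shift is injective, so distinct indices get distinct, hence
        disjoint, members of \<open>\<G>\<close>.\<close>
      define s where "s x = minim {y\<in>X. (x, y) \<in> r \<and> x \<noteq> y}" for x
      have s: "s x \<in> X" "(x, s x) \<in> r" "x \<noteq> s x" if "x \<in> K" for x
        using minim_in[of "{y\<in>X. (x, y) \<in> r \<and> x \<noteq> y}"] above[OF that] XK FK
        unfolding s_def by blast+
      have s_least: "(s x, y) \<in> r" if "y \<in> X" "(x, y) \<in> r" "x \<noteq> y" for x y
        unfolding s_def using that XK FK by (intro minim_least) auto
      have inj_s: "inj_on s X"
      proof (rule inj_onI)
        have *: "x = y" if "x \<in> X" "y \<in> X" "s x = s y" "(x, y) \<in> r" for x y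
        proof (rule ccontr)
          assume "x \<noteq> y"
          then have "(s y, y) \<in> r" using s_least[of y x] that by simp
          then show False
            using s[of y] that XK ANTISYM unfolding antisym_def by blast
        qed
        fix x y assume "x \<in> X" "y \<in> X" "s x = s y"
        then show "x = y"
          using *[of x y] *[of y x] TOTALS XK FK by auto
      qed
      have "\<forall>x\<in>X. \<exists>V. V \<in> \<G> \<and> h V = s x"
      proof
        fix x assume "x \<in> X"
        then have "s x \<in> h ` \<G>"
          using s(1)[of x] XK unfolding X_def by blast
        then show "\<exists>V. V \<in> \<G> \<and> h V = s x"
          by auto
      qed
      then obtain v where v: "\<forall>x\<in>X. v x \<in> \<G> \<and> h (v x) = s x"
        by (rule bchoice[THEN exE])
      have inj_v: "inj_on v X"
        using inj_s v unfolding inj_on_def by metis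
      have "disjoint_family_on v X"
        unfolding disjoint_family_on_def
      proof (intro ballI impI)
        fix x y assume xy: "x \<in> X" "y \<in> X" "x \<noteq> y"
        then have "v x \<noteq> v y"
          using inj_v by (simp add: inj_on_eq_iff)
        then show "v x \<inter> v y = {}"
          using v xy(1,2) \<G>(2) unfolding pairwise_def disjnt_def by simp
      qed
      then have "cells (UNIV::'a set) (Sigma X underS)"
      proof (rule cells_Sigma)
        fix x assume x: "x \<in> X"
        then show "cells (v x) (underS x)"
          using v s[of x] XK by (intro cells_below) auto
      qed simp
      \<comment> \<open>As \<open>X\<close> is unbounded, the combined family has at least
        \<open>|K|\<close> members, which contradicts \<open>c_hat\<close> not being
        attained.\<close>
      moreover have "K \<subseteq> (\<Union>x\<in>X. underS x)"
        using above unfolding underS_def by fastforce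
      then have "|K| \<le>o |Sigma X underS|"
        using card_of_mono1 card_of_UNION_Sigma ordLeq_transitive by blast
      ultimately have "cells (UNIV::'a set) K"
        by (rule cells_ordLeq)
      then have False
        using less_iff[of K] rK ordLess_irreflexive by auto
      then show ?thesis ..
    qed
  qed
qed

section \<open>Convex neighbourhoods and small cofinal sets\<close>

definition order_convex :: "'a::linorder set \<Rightarrow> bool" where
  "order_convex W \<longleftrightarrow> (\<forall>a\<in>W. \<forall>b\<in>W. {a..b} \<subseteq> W)"

text \<open>The neighbourhood is an open up-set \<open>A\<close> intersected with an open down-set
  \<open>B\<close>. On a side where \<open>x\<close> is an endpoint of the line, \<open>UNIV\<close>
  serves.\<close>

lemma open_order_convex_nbhd:
  fixes x :: "'a::linorder_topology"
  assumes "open U" "x \<in> U"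
  obtains W where "open W" "x \<in> W" "W \<subseteq> U" "order_convex W"
proof -
  have "\<exists>A. open A \<and> x \<in> A \<and> A \<inter> {..x} \<subseteq> U \<and> (\<forall>a\<in>A. {a..} \<subseteq> A)"
  proof (cases "\<exists>y. y < x")
    case True
    then obtain a where "a < x" "{a<..x} \<subseteq> U"
      using open_left[OF assms] by blast
    then show ?thesis
      by (intro exI[of _ "{a<..}"]) auto
  next
    case False
    then have "{..x} = {x}" by (auto simp: not_less order.antisym)
    then show ?thesis
      using assms(2) by (intro exI[of _ UNIV]) auto
  qed
  then obtain A where A: "open A" "x \<in> A" "A \<inter> {..x} \<subseteq> U" "\<forall>a\<in>A. {a..} \<subseteq> A"
    by blast
  have "\<exists>B. open B \<and> x \<in> B \<and> B \<inter> {x..} \<subseteq> U \<and> (\<forall>b\<in>B. {..b} \<subseteq> B)"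
  proof (cases "\<exists>y. x < y")
    case True
    then obtain b where "x < b" "{x..<b} \<subseteq> U"
      using open_right[OF assms] by blast
    then show ?thesis
      by (intro exI[of _ "{..<b}"]) auto
  next
    case False
    then have "{x..} = {x}" by (auto simp: not_less order.antisym)
    then show ?thesis
      using assms(2) by (intro exI[of _ UNIV]) auto
  qed
  then obtain B where B: "open B" "x \<in> B" "B \<inter> {x..} \<subseteq> U" "\<forall>b\<in>B. {..b} \<subseteq> B"
    by blast
  show thesis
  proof (rule that)
    show "open (A \<inter> B)" "x \<in> A \<inter> B"
      using A B by auto
    show "A \<inter> B \<subseteq> U"
    proof
      fix z assume "z \<in> A \<inter> B"
      then show "z \<in> U"
        using A(3) B(3) by (cases "z \<le> x") auto
    qed
    show "order_convex (A \<inter> B)"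
      using A(4) B(4) unfolding order_convex_def by fastforce
  qed
qed

lemma atLeastAtMost_subset_trans:
  fixes a :: "'a::linorder"
  assumes "{a..b} \<subseteq> U" "{b..c} \<subseteq> U"
  shows "{a..c} \<subseteq> U"
proof
  fix x assume "x \<in> {a..c}"
  then show "x \<in> U"
    using assms by (cases "x \<le> b") auto
qed

text \<open>
  The set \<open>D\<close> consists of the last points
  \<open>M\<close> of those components that have one, and of a point from each member of a maximal
  disjoint family of intervals that are bounded within their component.
\<close>

lemma small_cofinal_subset:
  fixes U :: "'a::{linorder_topology, perfect_space} set"
  assumes "open U"
  obtains D where "|D| <o c_hat TYPE('a)" "\<And>x. x \<in> U \<Longrightarrow> \<exists>d\<in>D. x \<le> d \<and> {x..d} \<subseteq> U"
proof -
  define M where "M = {m\<in>U. \<forall>y>m. \<not> {m..y} \<subseteq> U}"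
  \<comment> \<open>These neighbourhoods show that \<open>M\<close> is small: each stays below its
    \<open>m\<close>, and an overlap would join \<open>m\<close> inside \<open>U\<close> to a later
    point.\<close>
  obtain N where N: "\<And>m. m \<in> M \<Longrightarrow> open (N m) \<and> m \<in> N m \<and> N m \<subseteq> U \<and> order_convex (N m)"
  proof -
    have "\<forall>m\<in>M. \<exists>W. open W \<and> m \<in> W \<and> W \<subseteq> U \<and> order_convex W"
    proof
      fix m assume "m \<in> M"
      then have "m \<in> U" by (simp add: M_def)
      then obtain W where "open W" "m \<in> W" "W \<subseteq> U" "order_convex W"
        by (rule open_order_convex_nbhd[OF assms])
      then show "\<exists>W. open W \<and> m \<in> W \<and> W \<subseteq> U \<and> order_convex W"
        by blast
    qed
    then show thesis
      by (rule bchoice[THEN exE]) (use that in blast)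
  qed
  have N_below: "p \<le> m" if "m \<in> M" "p \<in> N m" for m p
  proof (rule ccontr)
    assume "\<not> p \<le> m"
    moreover have "{m..p} \<subseteq> U"
      using N[OF that(1)] that(2) unfolding order_convex_def by blast
    ultimately show False
      using that(1) unfolding M_def by auto
  qed
  have N_disj: "N m \<inter> N m' = {}" if "m \<in> M" "m' \<in> M" "m < m'" for m m'
  proof (rule ccontr)
    assume "N m \<inter> N m' \<noteq> {}"
    then obtain p where p: "p \<in> N m" "p \<in> N m'" by blast
    have "{p..m'} \<subseteq> U"
      using N[OF that(2)] p(2) unfolding order_convex_def by blast
    moreover have "{m..m'} \<subseteq> {p..m'}"
      using N_below[OF that(1) p(1)] by simp
    ultimately have "{m..m'} \<subseteq> U"
      by blast
    then show False
      using that unfolding M_def by blast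
  qed
  have "disjoint_family_on N M"
    unfolding disjoint_family_on_def
  proof (intro ballI impI)
    fix m m' assume "m \<in> M" "m' \<in> M" "m \<noteq> m'"
    then show "N m \<inter> N m' = {}"
      using N_disj[of m m'] N_disj[of m' m] by (cases m m' rule: linorder_cases) auto
  qed
  then have "cells (UNIV::'a set) M"
    unfolding cells_def using N by (intro exI[of _ N]) auto
  then have card_M: "|M| <o c_hat TYPE('a)"
    by (simp add: c_hat_iff_cells)
  \<comment> \<open>The bound \<open>c\<close> stays in the component of \<open>W\<close>, so the
    search for a further interval can resume from \<open>c\<close>.\<close>
  define \<Q> where "\<Q> = {W. open W \<and> W \<noteq> {} \<and> order_convex W \<and> (\<exists>c. \<forall>w\<in>W. w < c \<and> {w..c} \<subseteq> U)}"
  obtain \<W> where \<W>: "\<W> \<subseteq> \<Q>" "pairwise disjnt \<W>"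
    and max: "\<And>Q. Q \<in> \<Q> \<Longrightarrow> Q \<noteq> {} \<Longrightarrow> \<exists>W\<in>\<W>. Q \<inter> W \<noteq> {}"
    by (rule maximal_pairwise_disjnt[of \<Q>]) (rule that)
  have "cells (UNIV::'a set) \<W>"
    using \<W> unfolding \<Q>_def by (intro cellular_family_imp_cells) (auto simp: cellular_family_def)
  then have card_W: "|\<W>| <o c_hat TYPE('a)"
    by (simp add: c_hat_iff_cells)
  define \<rho> where "\<rho> W = (SOME w. w \<in> W)" for W :: "'a set"
  have \<rho>: "\<rho> W \<in> W" if "W \<in> \<W>" for W
  proof -
    have "\<exists>w. w \<in> W"
      using that \<W>(1) unfolding \<Q>_def by blast
    then show ?thesis
      unfolding \<rho>_def by (rule someI_ex)
  qed
  have convex: "{w..v} \<subseteq> W" if "W \<in> \<W>" "w \<in> W" "v \<in> W" for W w v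
    using that \<W>(1) unfolding \<Q>_def order_convex_def by blast
  have bounded: "\<exists>c. \<forall>w\<in>W. w < c \<and> {w..c} \<subseteq> U" if "W \<in> \<W>" for W
    using that \<W>(1) unfolding \<Q>_def by blast
  have sub_U: "{w..v} \<subseteq> U" if "W \<in> \<W>" "w \<in> W" "v \<in> W" for W w v
  proof -
    have "W \<subseteq> U"
      using bounded[OF that(1)] by (meson atLeastAtMost_iff less_imp_le order_refl subset_iff)
    with convex[OF that] show ?thesis by blast
  qed
  have cofinal: "\<exists>d\<in>M \<union> \<rho> ` \<W>. x \<le> d \<and> {x..d} \<subseteq> U" if x: "x \<in> U" for x
  proof (cases "\<exists>m\<in>M. x \<le> m \<and> {x..m} \<subseteq> U")
    case True
    then show ?thesis by blast
  next
    case False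
    \<comment> \<open>In this case the component of \<open>x\<close> has no last point.\<close>
    have further: "\<exists>z>y. {x..z} \<subseteq> U" if y: "x \<le> y" "{x..y} \<subseteq> U" for y
    proof -
      have "y \<notin> M" "y \<in> U"
        using False y by auto
      then obtain z where "z > y" "{y..z} \<subseteq> U"
        unfolding M_def by blast
      then show ?thesis
        using atLeastAtMost_subset_trans[OF y(2)] by blast
    qed
    \<comment> \<open>Moving right twice, to \<open>z\<close> and then \<open>c\<close>, leaves room
      for an interval around \<open>z\<close> between \<open>y\<close> and \<open>c\<close>. It
      belongs to \<open>\<Q>\<close>, so maximality applies.\<close>
    have W_above: "\<exists>W\<in>\<W>. \<exists>w\<in>W. y < w \<and> {x..w} \<subseteq> U" if y: "x \<le> y" "{x..y} \<subseteq> U" for y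
    proof -
      obtain z where z: "y < z" "{x..z} \<subseteq> U"
        using further[OF y] by blast
      have "x \<le> z"
        using y(1) z(1) by simp
      then obtain c where c: "z < c" "{x..c} \<subseteq> U"
        using further z(2) by blast
      have "z \<in> {y<..<c}"
        using z(1) c(1) by simp
      then obtain G where G: "open G" "z \<in> G" "G \<subseteq> {y<..<c}" "order_convex G"
        by (rule open_order_convex_nbhd[OF open_greaterThanLessThan])
      have "\<forall>w\<in>G. w < c \<and> {w..c} \<subseteq> U"
      proof
        fix w assume "w \<in> G"
        then have "y < w" "w < c" using G(3) by auto
        then have "{w..c} \<subseteq> {x..c}" using y(1) by auto
        then show "w < c \<and> {w..c} \<subseteq> U" using \<open>w < c\<close> c(2) by blast
      qed
      then have "G \<in> \<Q>"
        using G unfolding \<Q>_def by blast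
      then obtain W w where W: "W \<in> \<W>" "w \<in> W" "w \<in> G"
        using max[of G] G(2) by blast
      then have "y < w" "w < c"
        using G(3) by auto
      moreover have "{x..w} \<subseteq> {x..c}"
        using \<open>w < c\<close> by auto
      ultimately show ?thesis
        using W c(2) by blast
    qed
    obtain W w where W: "W \<in> \<W>" "w \<in> W" "x < w" "{x..w} \<subseteq> U"
      using W_above[of x] x by auto
    show ?thesis
    proof (cases "x \<le> \<rho> W")
      case True
      then show ?thesis
        using atLeastAtMost_subset_trans[OF W(4) sub_U[OF W(1,2) \<rho>[OF W(1)]]] W(1) by blast
    next
      case False
      \<comment> \<open>The chosen point of \<open>W\<close> lies left of \<open>x\<close>, so a
        second interval \<open>W'\<close> reaching beyond \<open>c\<close> is taken. If its chosen
        point were also left of \<open>x\<close>, convexity would put \<open>w\<close> into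
        \<open>W'\<close>, although \<open>W\<close> and \<open>W'\<close> are disjoint.\<close>
      obtain c where c: "\<forall>v\<in>W. v < c \<and> {v..c} \<subseteq> U"
        using bounded[OF W(1)] by blast
      have "{x..c} \<subseteq> U"
        using atLeastAtMost_subset_trans[OF W(4)] c W(2) by blast
      moreover have "x \<le> c"
        using c W(2,3) by force
      ultimately obtain W' w' where W': "W' \<in> \<W>" "w' \<in> W'" "c < w'" "{x..w'} \<subseteq> U"
        using W_above[of c] by blast
      have "W \<noteq> W'"
        using c W' by force
      then have disj: "W \<inter> W' = {}"
        using \<W>(2) W(1) W'(1) unfolding pairwise_def disjnt_def by blast
      have "x \<le> \<rho> W'"
      proof (rule ccontr)
        assume "\<not> x \<le> \<rho> W'"
        then have "w \<in> {\<rho> W'..w'}"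
          using W(2,3) W'(3) c by force
        then have "w \<in> W'"
          using convex[OF W'(1) \<rho>[OF W'(1)] W'(2)] by blast
        with disj W(2) show False by blast
      qed
      then show ?thesis
        using atLeastAtMost_subset_trans[OF W'(4) sub_U[OF W'(1,2) \<rho>[OF W'(1)]]] W'(1) by blast
    qed
  qed
  have "|M \<union> \<rho> ` \<W>| <o c_hat TYPE('a)"
  proof -
    obtain K :: "'a set set" where K: "c_hat TYPE('a) = |K|" "infinite K"
      by (rule c_hat_infinite)
    show ?thesis
      using card_M ordLeq_ordLess_trans[OF card_of_image card_W, of \<rho>] unfolding K(1)
      by (rule card_of_Un_ordLess_infinite[OF K(2)])
  qed
  then show thesis
    using cofinal by (rule that)
qed

section \<open>Density from \<open>os2\<close>\<close>

definition os2_family :: "'a::topological_space set set \<Rightarrow> bool" where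
  "os2_family \<U> \<longleftrightarrow> (\<forall>U\<in>\<U>. open U) \<and>
     (\<forall>G. open G \<and> G \<noteq> {} \<longrightarrow>
       (\<exists>U\<^sub>0\<in>\<U>. \<exists>U\<^sub>1\<in>\<U>. U\<^sub>0 \<inter> U\<^sub>1 = {} \<and> U\<^sub>0 \<inter> G \<noteq> {} \<and> U\<^sub>1 \<inter> G \<noteq> {}))"

lemma os2_eq: "os2 (L :: 'a::topological_space itself) = min_card (os2_family :: 'a set set \<Rightarrow> bool)"
  unfolding os2_def os2_family_def ..

lemma os2_family_open: "os2_family {U::'a::{t2_space, perfect_space} set. open U}"
  unfolding os2_family_def
proof (intro conjI allI impI)
  fix G :: "'a set" assume G: "open G \<and> G \<noteq> {}"
  obtain V W where "open V" "open W" "V \<noteq> {}" "W \<noteq> {}" "V \<inter> W = {}" "V \<subseteq> G" "W \<subseteq> G"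
    using perfect_t2_disjoint_open[OF conjunct1[OF G] conjunct2[OF G]] .
  then show "\<exists>U\<^sub>0\<in>{U. open U}. \<exists>U\<^sub>1\<in>{U. open U}. U\<^sub>0 \<inter> U\<^sub>1 = {} \<and> U\<^sub>0 \<inter> G \<noteq> {} \<and> U\<^sub>1 \<inter> G \<noteq> {}"
    by (intro bexI[of _ V] bexI[of _ W]) auto
qed simp

lemma top_density_less_c_hat:
  fixes L :: "'a::{linorder_topology, perfect_space} itself"
  assumes "os2 L <o c_hat L"
  shows "top_density L <o c_hat L"
proof -
  have c_hat: "c_hat L = c_hat TYPE('a)"
    unfolding c_hat_def ..
  obtain \<U> :: "'a set set" where \<U>: "os2_family \<U>" "min_card os2_family = |\<U>|"
    and "\<And>\<V>::'a set set. os2_family \<V> \<Longrightarrow> |\<U>| \<le>o |\<V>|"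
    by (rule min_card_witness[where P=os2_family, OF os2_family_open]) (rule that)
  have "\<exists>D. |D| <o c_hat TYPE('a) \<and> (\<forall>x\<in>U. \<exists>d\<in>D. x \<le> d \<and> {x..d} \<subseteq> U)" if "U \<in> \<U>" for U
  proof -
    have "open U" using \<U>(1) that unfolding os2_family_def by blast
    then obtain D where "|D| <o c_hat TYPE('a)" "\<And>x. x \<in> U \<Longrightarrow> \<exists>d\<in>D. x \<le> d \<and> {x..d} \<subseteq> U"
      by (rule small_cofinal_subset) (rule that)
    then show ?thesis
      by (intro exI[of _ D]) simp
  qed
  then have "\<forall>U\<in>\<U>. \<exists>D. |D| <o c_hat TYPE('a) \<and> (\<forall>x\<in>U. \<exists>d\<in>D. x \<le> d \<and> {x..d} \<subseteq> U)"
    by (rule ballI)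
  then obtain D where "\<forall>U\<in>\<U>. |D U| <o c_hat TYPE('a) \<and> (\<forall>x\<in>U. \<exists>d\<in>D U. x \<le> d \<and> {x..d} \<subseteq> U)"
    by (rule bchoice[THEN exE])
  then have D: "\<And>U. U \<in> \<U> \<Longrightarrow> |D U| <o c_hat TYPE('a)"
    and cofinal: "\<And>U x. U \<in> \<U> \<Longrightarrow> x \<in> U \<Longrightarrow> \<exists>d\<in>D U. x \<le> d \<and> {x..d} \<subseteq> U"
    by simp_all
  have meets: "(\<Union>U\<in>\<U>. D U) \<inter> G \<noteq> {}" if G: "open G" "G \<noteq> {}" for G
  proof -
    obtain x0 where "x0 \<in> G" using G(2) by blast
    then obtain W where W: "open W" "x0 \<in> W" "W \<subseteq> G" "order_convex W"
      by (rule open_order_convex_nbhd[OF G(1)])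
    \<comment> \<open>The point \<open>d\<close> is reached from \<open>x\<close> without leaving
      \<open>U\<close>, so it comes before \<open>y\<close>; convexity then keeps it in
      \<open>W\<close>.\<close>
    have hit: "\<exists>d\<in>\<Union>U\<in>\<U>. D U. d \<in> W"
      if hyps: "U \<in> \<U>" "x \<in> U" "y \<notin> U" "x \<in> W" "y \<in> W" "x < y" for U x y
    proof -
      obtain d where d: "d \<in> D U" "x \<le> d" "{x..d} \<subseteq> U"
        using cofinal hyps(1,2) by blast
      have "d < y"
      proof (rule ccontr)
        assume "\<not> d < y"
        then have "y \<in> {x..d}" using hyps(6) by (simp add: not_less less_imp_le)
        with d(3) hyps(3) show False by blast
      qed
      then have "d \<in> W"
        using d(2) \<open>d < y\<close> hyps(4,5) W(4) unfolding order_convex_def by fastforce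
      with d(1) hyps(1) show ?thesis by blast
    qed
    have "W \<noteq> {}" using W(2) by blast
    with W(1) \<U>(1) have "\<exists>U\<in>\<U>. \<exists>V\<in>\<U>. U \<inter> V = {} \<and> U \<inter> W \<noteq> {} \<and> V \<inter> W \<noteq> {}"
      unfolding os2_family_def by simp
    then obtain U V where UV: "U \<in> \<U>" "V \<in> \<U>" "U \<inter> V = {}" "U \<inter> W \<noteq> {}" "V \<inter> W \<noteq> {}"
      by (elim bexE conjE)
    then obtain x y where xy: "x \<in> U" "x \<in> W" "y \<in> V" "y \<in> W"
      by blast
    then have "x \<notin> V" "y \<notin> U" "x \<noteq> y"
      using UV(3) by auto
    then have "\<exists>d\<in>\<Union>U\<in>\<U>. D U. d \<in> W"
      using hit[OF UV(1) xy(1) _ xy(2,4)] hit[OF UV(2) xy(3) _ xy(4,2)]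
      by (cases x y rule: linorder_cases) simp_all
    then show ?thesis using W(3) by blast
  qed
  \<comment> \<open>Otherwise the complement of the closure would be a nonempty open set missed by
    the union.\<close>
  have "closure (\<Union>U\<in>\<U>. D U) = UNIV"
    using meets[of "- closure (\<Union>U\<in>\<U>. D U)"] closure_subset[of "\<Union>U\<in>\<U>. D U"] by auto
  then have "top_density L \<le>o |\<Union>U\<in>\<U>. D U|"
    unfolding top_density_def by (rule min_card_ordLeq)
  also have "|\<Union>U\<in>\<U>. D U| \<le>o |Sigma \<U> D|"
    by (rule card_of_UNION_Sigma)
  also have "|Sigma \<U> D| <o c_hat TYPE('a)"
    using assms D unfolding c_hat os2_eq \<U>(2) by (rule c_hat_regular)
  finally show ?thesis
    unfolding c_hat .
qed

section \<open>Nowhere constant images and weight\<close>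

text \<open>In any nonempty open \<open>G\<close> two points have distinct images. Disjoint basic
  neighbourhoods of these images pull back to disjoint open sets that both meet
  \<open>G\<close>.\<close>

lemma os2_ordLeq_weight:
  fixes L :: "'a::topological_space itself" and Y :: "'b::t2_space itself"
  assumes "nowhere_constant_image Y L"
  shows "os2 L \<le>o weight Y"
proof -
  obtain f :: "'a \<Rightarrow> 'b" where cont: "continuous_on UNIV f"
    and nc: "\<forall>U. open U \<and> U \<noteq> {} \<longrightarrow> (\<exists>y\<in>f ` U. \<exists>z\<in>f ` U. y \<noteq> z)"
    using assms unfolding nowhere_constant_image_def by (elim exE conjE)
  have "topological_basis {B::'b set. open B}"
    by (rule topological_basisI) auto
  then obtain \<B> :: "'b set set" where \<B>: "topological_basis \<B>" "min_card topological_basis = |\<B>|"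
    and "\<And>\<C>::'b set set. topological_basis \<C> \<Longrightarrow> |\<B>| \<le>o |\<C>|"
    by (rule min_card_witness[where P=topological_basis]) (rule that)
  then have weight: "weight Y = |\<B>|"
    by (simp add: weight_def)
  have "os2_family (vimage f ` \<B>)"
    unfolding os2_family_def
  proof (intro conjI allI impI)
    show "\<forall>U\<in>vimage f ` \<B>. open U"
      using \<B>(1) cont by (auto intro: open_vimage topological_basis_open)
    fix G :: "'a set" assume "open G \<and> G \<noteq> {}"
    with nc have "\<exists>y\<in>f ` G. \<exists>z\<in>f ` G. y \<noteq> z"
      by simp
    then obtain x y where xy: "x \<in> G" "y \<in> G" "f x \<noteq> f y"
      by blast
    obtain S T where "open S" "open T" "f x \<in> S" "f y \<in> T" "S \<inter> T = {}"
      using hausdorff[OF xy(3)] by blast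
    obtain B where "B \<in> \<B>" "f x \<in> B" "B \<subseteq> S"
      using topological_basisE[OF \<B>(1) \<open>open S\<close> \<open>f x \<in> S\<close>] .
    moreover obtain C where "C \<in> \<B>" "f y \<in> C" "C \<subseteq> T"
      using topological_basisE[OF \<B>(1) \<open>open T\<close> \<open>f y \<in> T\<close>] .
    ultimately show "\<exists>U\<^sub>0\<in>vimage f ` \<B>. \<exists>U\<^sub>1\<in>vimage f ` \<B>. U\<^sub>0 \<inter> U\<^sub>1 = {} \<and> U\<^sub>0 \<inter> G \<noteq> {} \<and> U\<^sub>1 \<inter> G \<noteq> {}"
      using xy(1,2) \<open>S \<inter> T = {}\<close>
      by (intro bexI[of _ "f -` B"] bexI[of _ "f -` C"]) auto
  qed
  then have "os2 L \<le>o |vimage f ` \<B>|"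
    unfolding os2_eq by (rule min_card_ordLeq)
  also have "|vimage f ` \<B>| \<le>o |\<B>|"
    by (rule card_of_image)
  finally show ?thesis
    unfolding weight .
qed

theorem theorem3p6:
  fixes L :: "'a::{linorder_topology, perfect_space} itself"
    and Y :: "'b::{t2_space, perfect_space} itself"
    and \<kappa> :: "'k rel"
  shows "(os2 L <o c_hat L \<longrightarrow> top_density L <o c_hat L) \<and>
    (Card_order \<kappa> \<and> natLeq <o \<kappa> \<and> regularCard \<kappa> \<and> Suslin_line \<kappa> L \<and>
      nowhere_constant_image Y L \<longrightarrow>
      \<kappa> \<le>o weight Y \<and> \<kappa> =o c_hat L)"
proof (intro conjI impI)
  show density: "top_density L <o c_hat L" if "os2 L <o c_hat L"
    using that by (rule top_density_less_c_hat)
  assume *: "Card_order \<kappa> \<and> natLeq <o \<kappa> \<and> regularCard \<kappa> \<and> Suslin_line \<kappa> L \<and>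
    nowhere_constant_image Y L"
  then have eq: "c_hat L =o \<kappa>" and le: "\<kappa> \<le>o top_density L"
    unfolding Suslin_line_def c_hat_def top_density_def by auto
  show "\<kappa> =o c_hat L"
    using eq by (rule ordIso_symmetric)
  show "\<kappa> \<le>o weight Y"
  proof (rule ccontr)
    \<comment> \<open>A weight below \<open>\<kappa>\<close> pushes \<open>os2 L\<close> below
      \<open>c_hat L\<close>; the first part then makes the density smaller than
      \<open>\<kappa>\<close>, against the Suslin property.\<close>
    assume "\<not> \<kappa> \<le>o weight Y"
    moreover have "Well_order \<kappa>" "Well_order (weight Y)"
      using * by (simp_all add: card_order_on_def weight_def min_card_def card_of_Well_order)
    ultimately have "weight Y <o \<kappa>"
      by (simp add: not_ordLeq_iff_ordLess)
    with * have "os2 L <o \<kappa>"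
      using ordLeq_ordLess_trans[OF os2_ordLeq_weight] by blast
    then have "os2 L <o c_hat L"
      using ordIso_symmetric[OF eq] by (rule ordLess_ordIso_trans)
    then have "top_density L <o \<kappa>"
      using ordLess_ordIso_trans[OF density eq] by blast
    with le show False
      using not_ordLess_ordLeq by blast
  qed
qed

end
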